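(* For every integer $e\ge 3$ there exists a strongly equitable $2$-chromatic $e$-star system of order $2e$, i.e. a $2$-chromatic $e$-star system of order $2e$ admitting a $2$-colouring whose two colour classes each have exactly $e$ vertices.
   Context: An $e$-star is the complete bipartite graph $K_{1,e}$. An $e$-star system of order $n$ is a pair $(V,\mathcal B)$ where $|V|=n$ and $\mathcal B$ is a set of $e$-stars (subgraphs of the complete graph $K_n$ on $V$) whose edge sets partition the edge set of $K_n$. An $e$-star system is $k$-colourable if $V$ can be partitioned into $k$ sets (colour classes) such that no star in $\mathcal B$ has all its vertices in the same class; it is $k$-chromatic if it is $k$-colourable but not $(k-1)$-colourable. A colouring is strongly equitable if all colour classes have the same size; a system is strongly equitable $k$-chromatic if it is $k$-chromatic and admits a strongly equitable $k$-colouring. *)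

theory Defs
  imports Main "HOL-Library.Disjoint_Sets"
begin

datatype 'a ugraph = Ugraph (verts: "'a set") (edges: "'a set set")

definition subgraph :: "'a ugraph \<Rightarrow> 'a ugraph \<Rightarrow> bool" where
  "subgraph H G \<longleftrightarrow> verts H \<subseteq> verts G \<and> edges H \<subseteq> edges G"

definition complete_graph :: "'a set \<Rightarrow> 'a ugraph" where
  "complete_graph V = Ugraph V {{u, v} | u v. u \<in> V \<and> v \<in> V \<and> u \<noteq> v}"

definition is_complete_bipartite :: "nat \<Rightarrow> nat \<Rightarrow> 'a ugraph \<Rightarrow> bool" where
  "is_complete_bipartite m n G \<longleftrightarrow>
     (\<exists>X Y. finite X \<and> finite Y \<and> card X = m \<and> card Y = n \<and> X \<inter> Y = {} \<and>
        verts G = X \<union> Y \<and> edges G = {{x, y} | x y. x \<in> X \<and> y \<in> Y})"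

definition is_star :: "nat \<Rightarrow> 'a ugraph \<Rightarrow> bool" where
  "is_star e S \<longleftrightarrow> is_complete_bipartite 1 e S"

definition star_system :: "nat \<Rightarrow> nat \<Rightarrow> 'a set \<Rightarrow> 'a ugraph set \<Rightarrow> bool" where
  "star_system e n V B \<longleftrightarrow>
     finite V \<and> card V = n \<and>
     (\<forall>S\<in>B. is_star e S \<and> subgraph S (complete_graph V)) \<and>
     disjoint_family_on edges B \<and> (\<Union>S\<in>B. edges S) = edges (complete_graph V)"

(* The colour classes are the members of P; partition_on makes them nonempty. *)
definition is_colouring :: "nat \<Rightarrow> 'a set \<Rightarrow> 'a ugraph set \<Rightarrow> 'a set set \<Rightarrow> bool" where
  "is_colouring k V B P \<longleftrightarrow>
     partition_on V P \<and> finite P \<and> card P = k \<and> (\<forall>S\<in>B. \<not> (\<exists>C\<in>P. verts S \<subseteq> C))"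

definition colourable :: "nat \<Rightarrow> 'a set \<Rightarrow> 'a ugraph set \<Rightarrow> bool" where
  "colourable k V B \<longleftrightarrow> (\<exists>P. is_colouring k V B P)"

definition chromatic :: "nat \<Rightarrow> 'a set \<Rightarrow> 'a ugraph set \<Rightarrow> bool" where
  "chromatic k V B \<longleftrightarrow> colourable k V B \<and> \<not> colourable (k - 1) V B"

definition strongly_equitable :: "'a set set \<Rightarrow> bool" where
  "strongly_equitable P \<longleftrightarrow> (\<forall>C\<in>P. \<forall>D\<in>P. card C = card D)"

definition strongly_equitable_chromatic :: "nat \<Rightarrow> 'a set \<Rightarrow> 'a ugraph set \<Rightarrow> bool" where
  "strongly_equitable_chromatic k V B \<longleftrightarrow>
     chromatic k V B \<and> (\<exists>P. is_colouring k V B P \<and> strongly_equitable P)"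

end

theory Submission
  imports Defs
begin

text \<open>
  An $e$-star has $e + 1$ vertices, so no partition into classes of size $e$ contains a
  monochromatic star; hence every $e$-star system of order $2e$ is strongly equitable 2-chromatic.
  Such a system amounts to an orientation of $K_{2e}$ in which $2e - 1$ vertices have out-degree $e$:
  take the rotational regular tournament on $2e - 1$ vertices, of out-degree $e - 1$, and let
  every vertex dominate one additional vertex.
\<close>

definition star :: "'a \<Rightarrow> 'a set \<Rightarrow> 'a ugraph" where
  "star c L = Ugraph (insert c L) {{c, y} | y. y \<in> L}"

lemma is_star_star:
  assumes "finite L" "card L = e" "c \<notin> L"
  shows "is_star e (star c L)"
  unfolding is_star_def is_complete_bipartite_def star_def
  by (rule exI[of _ "{c}"], rule exI[of _ L]) (use assms in auto)

lemma subgraph_star_complete_graph: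
  assumes "c \<in> V" "L \<subseteq> V" "c \<notin> L"
  shows "subgraph (star c L) (complete_graph V)"
  using assms by (auto simp: subgraph_def star_def complete_graph_def)

lemma card_verts_star:
  assumes "is_star e S"
  shows "card (verts S) = Suc e"
proof -
  obtain X Y where "finite X" "finite Y" "card X = 1" "card Y = e" "X \<inter> Y = {}" "verts S = X \<union> Y"
    using assms unfolding is_star_def is_complete_bipartite_def by (elim exE conjE) (rule that)
  then show ?thesis by (simp add: card_Un_disjoint)
qed

text \<open>Read \<open>L c\<close> as the out-neighbourhood of \<open>c\<close>: each edge goes to
  the star centred at its tail. Since \<open>antisym\<close> allows only one tail, edge sets are
  disjoint; since \<open>total\<close> supplies one in \<open>C\<close>, every edge is
  covered.\<close>

lemma star_system_of_orientation:
  assumes "finite V" "card V = n" "C \<subseteq> V"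
    and out: "\<And>c. c \<in> C \<Longrightarrow> L c \<subseteq> V - {c} \<and> card (L c) = e"
    and antisym: "\<And>c d. c \<in> C \<Longrightarrow> d \<in> C \<Longrightarrow> d \<in> L c \<Longrightarrow> c \<notin> L d"
    and total: "\<And>u v. u \<in> V \<Longrightarrow> v \<in> V \<Longrightarrow> u \<noteq> v \<Longrightarrow> u \<in> C \<and> v \<in> L u \<or> v \<in> C \<and> u \<in> L v"
  shows "star_system e n V ((\<lambda>c. star c (L c)) ` C)"
proof -
  have sub: "subgraph (star c (L c)) (complete_graph V)" if "c \<in> C" for c
    using that out assms(3) by (intro subgraph_star_complete_graph) auto
  have star: "is_star e (star c (L c))" if "c \<in> C" for c
    using out[OF that] finite_subset[OF _ assms(1)] by (intro is_star_star) auto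
  have "disjoint_family_on edges ((\<lambda>c. star c (L c)) ` C)"
    unfolding disjoint_family_on_def
  proof (intro ballI impI)
    fix S T assume "S \<in> (\<lambda>c. star c (L c)) ` C" "T \<in> (\<lambda>c. star c (L c)) ` C" "S \<noteq> T"
    then obtain c d where "c \<in> C" "d \<in> C" "c \<noteq> d" "S = star c (L c)" "T = star d (L d)"
      by blast
    \<comment> \<open>With \<open>c \<noteq> d\<close>, a common edge must be \<open>{c, d}\<close>,
      which would be oriented both ways.\<close>
    then show "edges S \<inter> edges T = {}"
      using antisym[of c d] by (auto simp: star_def doubleton_eq_iff)
  qed
  moreover have "edges (complete_graph V) \<subseteq> (\<Union>c\<in>C. edges (star c (L c)))"
  proof
    fix x assume "x \<in> edges (complete_graph V)"
    then obtain u v where "x = {u, v}" "u \<in> V" "v \<in> V" "u \<noteq> v"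
      by (auto simp: complete_graph_def)
    then show "x \<in> (\<Union>c\<in>C. edges (star c (L c)))"
      using total[of u v] by (auto simp: star_def insert_commute)
  qed
  ultimately show ?thesis
    using assms(1,2) star sub unfolding star_system_def subgraph_def
    by (simp add: UN_least subset_antisym)
qed

lemma is_colouring_of_small_classes:
  assumes "star_system e n V B" "partition_on V P" "card P = k"
    and "\<And>C. C \<in> P \<Longrightarrow> card C \<le> e"
  shows "is_colouring k V B P"
proof -
  have V: "finite V" and star: "\<And>S. S \<in> B \<Longrightarrow> is_star e S"
    using assms(1) by (auto simp: star_system_def)
  have "\<not> verts S \<subseteq> C" if "S \<in> B" "C \<in> P" for S C
  proof
    assume "verts S \<subseteq> C"
    \<comment> \<open>An infinite class would have \<open>card C = 0\<close> and satisfy the size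
      bound vacuously.\<close>
    moreover have "finite C"
      using V partition_onD1[OF assms(2)] that(2) by (metis Sup_upper finite_subset)
    ultimately show False
      using card_mono[of C "verts S"] card_verts_star[OF star[OF that(1)]] assms(4)[OF that(2)]
      by simp
  qed
  then show ?thesis
    using assms(2,3) finite_elements[OF V assms(2)] by (auto simp: is_colouring_def)
qed

text \<open>The only class is \<open>V\<close> itself, and it contains the vertices of any
  star.\<close>

lemma star_system_not_1_colourable:
  assumes "star_system e n V B" "B \<noteq> {}"
  shows "\<not> colourable 1 V B"
proof
  assume "colourable 1 V B"
  then obtain C where "partition_on V {C}" and C: "\<forall>S\<in>B. \<not> verts S \<subseteq> C"
    by (auto simp: colourable_def is_colouring_def card_1_singleton_iff)
  then have "V = C" by (auto simp: partition_on_def)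
  with assms C show False
    by (auto simp: star_system_def subgraph_def complete_graph_def)
qed

text \<open>
  The out-neighbourhood of a vertex below $2e - 1$: its $e - 1$ cyclic successors modulo $2e - 1$
  (the second interval being those that wrap around; it is empty by truncation when none do),
  and the additional vertex $2e - 1$.
\<close>

definition rotational_out :: "nat \<Rightarrow> nat \<Rightarrow> nat set" where
  "rotational_out e i = {i<..<min (i + e) (2 * e - 1)} \<union> {..<i + 1 - e} \<union> {2 * e - 1}"

text \<open>For \<open>i < e\<close> the intervals have e - 1 and 0 elements; otherwise 2e - 2 - i
  and i + 1 - e. Either way they total e - 1.\<close>

lemma card_rotational_out:
  assumes "i < 2 * e - 1"
  shows "card (rotational_out e i) = e"
proof -
  have "card (rotational_out e i) = card ({i<..<min (i + e) (2 * e - 1)} \<union> {..<i + 1 - e}) + 1"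
    unfolding rotational_out_def using assms by (subst card_Un_disjoint) auto
  also have "card ({i<..<min (i + e) (2 * e - 1)} \<union> {..<i + 1 - e})
      = card {i<..<min (i + e) (2 * e - 1)} + card {..<i + 1 - e}"
    using assms by (intro card_Un_disjoint) auto
  also have "\<dots> + 1 = e"
    using assms by (simp add: min_def)
  finally show ?thesis .
qed

text \<open>For distinct vertices below 2e - 1, the two cyclic distances sum to 2e - 1 = (e - 1) +
  e, so exactly one is at most e - 1. The vertex 2e - 1 centres no star and is dominated by all
  others.\<close>

lemma star_system_rotational:
  assumes "e \<ge> 1"
  shows "star_system e (2 * e) {..<2 * e} ((\<lambda>i. star i (rotational_out e i)) ` {..<2 * e - 1})"
proof (rule star_system_of_orientation)
  fix c assume c: "c \<in> {..<2 * e - 1}"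
  then have "rotational_out e c \<subseteq> {..<2 * e} - {c}"
    using assms by (auto simp: rotational_out_def)
  then show "rotational_out e c \<subseteq> {..<2 * e} - {c} \<and> card (rotational_out e c) = e"
    using c card_rotational_out by simp
next
  fix c d assume "c \<in> {..<2 * e - 1}" "d \<in> {..<2 * e - 1}" "d \<in> rotational_out e c"
  then show "c \<notin> rotational_out e d"
    by (auto simp: rotational_out_def)
next
  fix u v assume "u \<in> {..<2 * e}" "v \<in> {..<2 * e}" "u \<noteq> v"
  then show "u \<in> {..<2 * e - 1} \<and> v \<in> rotational_out e u \<or>
      v \<in> {..<2 * e - 1} \<and> u \<in> rotational_out e v"
    by (simp add: rotational_out_def) linarith
qed auto

theorem theorem3p1:
  fixes e :: nat
  assumes "e \<ge> 3"
  shows "\<exists>(V :: nat set) B. star_system e (2 * e) V B \<and>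
           strongly_equitable_chromatic 2 V B \<and>
           (\<exists>P. is_colouring 2 V B P \<and> (\<forall>C\<in>P. card C = e))"
proof -
  define V where "V = {..<2 * e}"
  define B where "B = (\<lambda>i. star i (rotational_out e i)) ` {..<2 * e - 1}"
  define P where "P = {{..<e}, {e..<2 * e}}"
  have sys: "star_system e (2 * e) V B"
    unfolding V_def B_def using assms by (intro star_system_rotational) simp
  have P: "\<forall>C\<in>P. card C = e" by (simp add: P_def)
  \<comment> \<open>The elements 0 and e witness that the halves are nonempty and distinct, so the
    set \<open>P\<close> does not collapse to one class.\<close>
  have "0 \<in> {..<e}" "e \<in> {e..<2 * e}" "0 \<notin> {e..<2 * e}"
    using assms by simp_all
  then have ne: "{..<e} \<noteq> {}" "{e..<2 * e} \<noteq> {}" "{..<e} \<noteq> {e..<2 * e}"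
    by blast+
  then have "card P = 2" by (simp add: P_def)
  moreover have "partition_on V P"
  proof (rule partition_onI)
    show "\<Union> P = V" by (auto simp: P_def V_def)
    show "{} \<notin> P"
      using ne unfolding P_def by blast
    have "disjnt {..<e} {e..<2 * e}" by (auto simp: disjnt_def)
    then show "disjnt C D" if "C \<in> P" "D \<in> P" "C \<noteq> D" for C D
      using that disjnt_sym unfolding P_def by blast
  qed
  ultimately have col: "is_colouring 2 V B P"
    using sys P by (intro is_colouring_of_small_classes) auto
  have "0 \<in> {..<2 * e - 1}" using assms by simp
  then have "B \<noteq> {}" unfolding B_def by blast
  then have "\<not> colourable (2 - 1) V B"
    using star_system_not_1_colourable[OF sys] by simp
  then have "strongly_equitable_chromatic 2 V B"
    using col P unfolding strongly_equitable_chromatic_def chromatic_def colourable_def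
      strongly_equitable_def by auto
  with sys col P show ?thesis by blast
qed

end
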